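(* Algorithm $\mathcal{D}$ described in the context implements all $d$-disagreement SOS problems $\Pi_O$ with $O=\{\{v_1,\dots,v_d\}\}$ (where $d\ge 1$ and $v_1,\dots,v_d$ are distinct values) under asynchrony and up to $f$ crash failures, assuming $$n \ \ge\ d\left\lceil \frac{f+1}{2}\right\rceil+\left\lfloor \frac{f+1}{2}\right\rfloor .$$
   Context: Computing model. A system consists of a nonempty finite set $P=\{p_1,\dots,p_n\}$ of $n$ processes. Processes are deterministic and take steps according to their local state and the events they observe, following an algorithm $A$. In an execution, a process may crash (halt prematurely and take no further step) but does not otherwise deviate from its algorithm; at most $f$ processes may crash in an execution, with $0 \le f \le n$. A process that does not crash in an execution is correct in it. Each process has a private local clock, running at its own pace, usable to set local timeouts. Processes interact through two operations: "communicate $I$" (disseminate information $I$ to all processes) and the callback "observe $I$" (be notified that $I$ was communicated), satisfying: (C-Validity) if a process observes $I$, then $I$ was previously communicated by some process; (C-Integrity) a process observes information $I$ communicated by a given process at most once; (C-Local-Termination) if a correct process communicates $I$, then some correct process (if there is any) eventually observes $I$; (C-Global-Termination) if a correct process observes $I$, then all correct processes eventually observe $I$. The system is asynchronous: there is no bound on communication delays, and any ordering or timing of observations consistent with these properties can occur. Tasks. $\mathbb{V}$ is a finite universe of values and $\bot \notin \mathbb{V}$ denotes no input or no output. For a system of size $n$, an input vector $V_{\rm in}$ and an output vector $V_{\rm out}$ are elements of $(\mathbb{V}\cup\{\bot\})^n$, whose $i$-th entries are the input and output values of process $p_i$. A process outputs at most one value in an execution. A task is a triple $T=(\mathcal{I},\mathcal{O},\Delta)$,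 where $\mathcal I,\mathcal O$ are sets of input and output vectors and $\Delta\subseteq\mathcal I\times\mathcal O$ is a nonempty relation whose pairs consist of vectors of the same size. $T_n=(\mathcal I_n,\mathcal O_n,\Delta_n)$ is the restriction of $T$ to vectors of size $n$. An algorithm $A$ implements $T$ if $T=(\mathcal I_A,\mathcal O_A,\Delta_A)$, where $\mathcal I_A,\mathcal O_A$ are the sets of input/output vectors admitted by $A$ and $\Delta_A$ is the set of pairs $(V_{\rm in},V_{\rm out})$ it produces across all its executions. $A$ supports a size $n$ if it admits executions with $n$ processes. SOS problems. The output set of an output vector is $\mathit{OS}(V_{\rm out})=\{v : v \text{ is an entry of } V_{\rm out},\ v\neq\bot\}$. For a task $T$, $\mathit{SOS}(T)=\{\mathit{OS}(V_{\rm out}) : (V_{\rm in},V_{\rm out})\in\Delta\}$. For nonempty $O\subseteq 2^{\mathbb V}$, the SOS problem $\Pi_O$ is the set of all (nonempty) tasks $T$ such that for every $n$ with $T_n\neq\varnothing$: (i) $\mathit{SOS}(T_n)=O$, and (ii) $\Delta_n=\mathcal I_n\times\mathcal O_n$. An algorithm solves (implements) $\Pi_O$ if it implements some task $T\in\Pi_O$. This amounts to giving an algorithm $A$ that, besides satisfying (ii) (for which it suffices to ignore inputs), satisfies: (Safety) every execution of $A$ produces an output vector $V_{\rm out}$ with $\mathit{OS}(V_{\rm out})\in O$; (Completeness) for every size $n$ supported by $A$ and every $o\in O$, some execution of $A$ produces an output vector of size $n$ with output set $o$. A $d$-disagreement SOS problem is $\Pi_O$ with $O=\{\{v_1,\dots,v_d\}\}$,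 so every execution must produce exactly the $d$ distinct output values $v_1,\dots,v_d$. Algorithm $\mathcal{D}$. Initialization: create a partition $P_1,\dots,P_d,P_?$ of $P$ such that $|P_?|=n-d\lceil\frac{f+1}{2}\rceil$ and $|P_i|=\lceil\frac{f+1}{2}\rceil$ for every $i\in\{1,\dots,d\}$. Code of every process in $P_i$, $i\in\{1,\dots,d\}$: output $v_i$; then communicate $\mathrm{OUTPUT}(v_i)$. Code of every process $p^?\in P_?$: wait until $p^?$ has observed $d-1$ distinct $\mathrm{OUTPUT}(\cdot)$; let $V_{\rm obs}=\{v : p^? \text{ observed } \mathrm{OUTPUT}(v)\}$; output $v\in\{v_1,\dots,v_d\}\setminus V_{\rm obs}$. *)

theory Defs
  imports Complex_Main "HOL-Library.Disjoint_Sets"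
begin

section \<open>Vectors, tasks and SOS problems\<close>

text \<open>The finite universe of values is a type \<open>'v::finite\<close>; \<open>None\<close> plays the role of \<open>\<bottom>\<close>.
  A vector of size \<open>n\<close> is a list of length \<open>n\<close>, and entry \<open>i < n\<close> belongs to process \<open>i\<close>:
  the processes of a system of size \<open>n\<close> are \<open>0, ..., n - 1\<close>.\<close>

type_synonym 'v vec = "'v option list"

type_synonym 'v task = "'v vec set \<times> 'v vec set \<times> ('v vec \<times> 'v vec) set"

definition is_task :: "'v task \<Rightarrow> bool" where
  "is_task T \<longleftrightarrow> (case T of (In, Out, \<Delta>) \<Rightarrow>
     \<Delta> \<subseteq> In \<times> Out \<and> \<Delta> \<noteq> {} \<and> (\<forall>(x, y) \<in> \<Delta>. length x = length y))"

definition restrict_task :: "'v task \<Rightarrow> nat \<Rightarrow> 'v task" where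
  "restrict_task T n = (case T of (In, Out, \<Delta>) \<Rightarrow>
     ({x \<in> In. length x = n}, {y \<in> Out. length y = n},
      {(x, y) \<in> \<Delta>. length x = n \<and> length y = n}))"

definition output_set :: "'v vec \<Rightarrow> 'v set" where
  "output_set y = {v. Some v \<in> set y}"

definition SOS :: "'v task \<Rightarrow> 'v set set" where
  "SOS T = (case T of (In, Out, \<Delta>) \<Rightarrow> {output_set y | x y. (x, y) \<in> \<Delta>})"

definition SOS_problem :: "'v set set \<Rightarrow> 'v task set" where
  "SOS_problem Os = {T. is_task T \<and>
     (\<forall>n. restrict_task T n \<noteq> ({}, {}, {}) \<longrightarrow>
        SOS (restrict_task T n) = Os \<and>
        (case restrict_task T n of (In, Out, \<Delta>) \<Rightarrow> \<Delta> = In \<times> Out))}"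


section \<open>Algorithms and their executions\<close>

datatype ('m, 'v) action = Output 'v | Communicate 'm | Skip

text \<open>Every process is a deterministic automaton. Its initial state depends on the system size,
  on its own index and on its own input. In a local step, a process in state \<open>s\<close> performs the
  action \<open>act s\<close> and moves to the state \<open>step s\<close>; it also reacts to the observation of an
  information and to a tick of its local clock. Algorithms may count ticks to implement timeouts.
  The field \<open>inputs\<close> is the set of input vectors that the algorithm admits; it also fixes
  the system sizes in which the algorithm may be run.\<close>

record ('s, 'm, 'v) algorithm =
  inputs :: "'v vec set"
  init :: "nat \<Rightarrow> nat \<Rightarrow> 'v option \<Rightarrow> 's"
  act :: "'s \<Rightarrow> ('m, 'v) action"
  step :: "'s \<Rightarrow> 's"
  on_observe :: "'m \<Rightarrow> 's \<Rightarrow> 's"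
  on_tick :: "'s \<Rightarrow> 's"

text \<open>\<open>Observe p q I\<close>: process \<open>p\<close> observes the information \<open>I\<close> communicated by \<open>q\<close>. The identity
  of \<open>q\<close> is bookkeeping of the model and is not passed to the algorithm. \<open>Idle\<close> lets an execution
  be an infinite sequence of events even if all processes crash.\<close>

datatype 'm event = Local nat | Observe nat nat 'm | Tick nat | Crash nat | Idle

fun actor :: "'m event \<Rightarrow> nat option" where
  "actor (Local p) = Some p"
| "actor (Observe p q I) = Some p"
| "actor (Tick p) = Some p"
| "actor (Crash p) = Some p"
| "actor Idle = None"

fun apply_event :: "('s, 'm, 'v) algorithm \<Rightarrow> 'm event \<Rightarrow> 's \<Rightarrow> 's" where
  "apply_event A (Local p) s = step A s"
| "apply_event A (Observe p q I) s = on_observe A I s"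
| "apply_event A (Tick p) s = on_tick A s"
| "apply_event A (Crash p) s = s"
| "apply_event A Idle s = s"

text \<open>The state of process \<open>p\<close> just before the event number \<open>t\<close> of the sequence \<open>e\<close>, started on the
  input vector \<open>x\<close>.\<close>

primrec state_at ::
    "('s, 'm, 'v) algorithm \<Rightarrow> 'v vec \<Rightarrow> (nat \<Rightarrow> 'm event) \<Rightarrow> nat \<Rightarrow> nat \<Rightarrow> 's" where
  "state_at A x e p 0 = init A (length x) p (x ! p)"
| "state_at A x e p (Suc t) =
     (if actor (e t) = Some p then apply_event A (e t) (state_at A x e p t)
      else state_at A x e p t)"

definition performs ::
    "('s, 'm, 'v) algorithm \<Rightarrow> 'v vec \<Rightarrow> (nat \<Rightarrow> 'm event) \<Rightarrow> nat \<Rightarrow> nat \<Rightarrow> ('m, 'v) action \<Rightarrow> bool"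
  where
  "performs A x e t p a \<longleftrightarrow> e t = Local p \<and> act A (state_at A x e p t) = a"

definition crashed :: "(nat \<Rightarrow> 'm event) \<Rightarrow> nat set" where
  "crashed e = {p. \<exists>t. e t = Crash p}"

definition correct :: "nat \<Rightarrow> (nat \<Rightarrow> 'm event) \<Rightarrow> nat set" where
  "correct n e = {..<n} - crashed e"

definition observes :: "(nat \<Rightarrow> 'm event) \<Rightarrow> nat \<Rightarrow> 'm \<Rightarrow> bool" where
  "observes e p I \<longleftrightarrow> (\<exists>t q. e t = Observe p q I)"

definition C_Validity ::
    "('s, 'm, 'v) algorithm \<Rightarrow> 'v vec \<Rightarrow> (nat \<Rightarrow> 'm event) \<Rightarrow> bool" where
  "C_Validity A x e \<longleftrightarrow>
     (\<forall>t p q I. e t = Observe p q I \<longrightarrow> (\<exists>t' < t. performs A x e t' q (Communicate I)))"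

definition C_Integrity :: "(nat \<Rightarrow> 'm event) \<Rightarrow> bool" where
  "C_Integrity e \<longleftrightarrow>
     (\<forall>t t' p q I. e t = Observe p q I \<and> e t' = Observe p q I \<longrightarrow> t = t')"

definition C_Local_Termination ::
    "('s, 'm, 'v) algorithm \<Rightarrow> 'v vec \<Rightarrow> (nat \<Rightarrow> 'm event) \<Rightarrow> bool" where
  "C_Local_Termination A x e \<longleftrightarrow>
     (\<forall>p \<in> correct (length x) e. \<forall>t I. performs A x e t p (Communicate I) \<longrightarrow>
        (\<exists>p' \<in> correct (length x) e. observes e p' I))"

definition C_Global_Termination :: "nat \<Rightarrow> (nat \<Rightarrow> 'm event) \<Rightarrow> bool" where
  "C_Global_Termination n e \<longleftrightarrow>
     (\<forall>p \<in> correct n e. \<forall>I. observes e p I \<longrightarrow> (\<forall>p' \<in> correct n e. observes e p' I))"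

text \<open>Executions with at most \<open>f\<close> crashes. A crashed process takes part in no later event, and a
  correct process takes infinitely many local steps (possibly \<open>Skip\<close>s) and clock ticks. Nothing
  else constrains the order or the timing of events, which is the asynchrony assumption.\<close>

definition execution ::
    "nat \<Rightarrow> ('s, 'm, 'v) algorithm \<Rightarrow> 'v vec \<Rightarrow> (nat \<Rightarrow> 'm event) \<Rightarrow> bool" where
  "execution f A x e \<longleftrightarrow>
     x \<in> inputs A \<and> 0 < length x \<and> f \<le> length x \<and>
     (\<forall>t p. actor (e t) = Some p \<longrightarrow> p < length x) \<and>
     (\<forall>t t' p. e t = Crash p \<and> t < t' \<longrightarrow> actor (e t') \<noteq> Some p) \<and>
     card (crashed e) \<le> f \<and>
     (\<forall>p \<in> correct (length x) e. infinite {t. e t = Local p} \<and> infinite {t. e t = Tick p}) \<and>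
     C_Validity A x e \<and> C_Integrity e \<and>
     C_Local_Termination A x e \<and> C_Global_Termination (length x) e"

definition output_vector ::
    "('s, 'm, 'v) algorithm \<Rightarrow> 'v vec \<Rightarrow> (nat \<Rightarrow> 'm event) \<Rightarrow> 'v vec" where
  "output_vector A x e =
     map (\<lambda>p. if \<exists>t v. performs A x e t p (Output v)
              then Some (THE v. \<exists>t. performs A x e t p (Output v)) else None) [0..<length x]"

definition outputs_at_most_once :: "nat \<Rightarrow> ('s, 'm, 'v) algorithm \<Rightarrow> bool" where
  "outputs_at_most_once f A \<longleftrightarrow>
     (\<forall>x e p t t' v v'. execution f A x e \<and>
        performs A x e t p (Output v) \<and> performs A x e t' p (Output v') \<longrightarrow> t = t')"

definition algorithm_task :: "nat \<Rightarrow> ('s, 'm, 'v) algorithm \<Rightarrow> 'v task" where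
  "algorithm_task f A =
     (inputs A,
      {output_vector A x e | x e. execution f A x e},
      {(x, output_vector A x e) | x e. execution f A x e})"

definition implements_task :: "nat \<Rightarrow> ('s, 'm, 'v) algorithm \<Rightarrow> 'v task \<Rightarrow> bool" where
  "implements_task f A T \<longleftrightarrow> outputs_at_most_once f A \<and> T = algorithm_task f A"

definition implements_problem :: "nat \<Rightarrow> ('s, 'm, 'v) algorithm \<Rightarrow> 'v task set \<Rightarrow> bool" where
  "implements_problem f A Ts \<longleftrightarrow> (\<exists>T \<in> Ts. implements_task f A T)"


section \<open>Algorithm \<open>\<D>\<close>\<close>

text \<open>\<open>part (Some i)\<close> is the group \<open>P\<^sub>i\<close> for \<open>i \<in> {1..d}\<close>, and \<open>part None\<close> is \<open>P\<^sub>?\<close>, which may be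
  empty (so that the library's \<open>partition_on\<close> does not apply).\<close>

definition D_partition :: "nat \<Rightarrow> nat \<Rightarrow> nat \<Rightarrow> (nat option \<Rightarrow> nat set) \<Rightarrow> bool" where
  "D_partition d f n part \<longleftrightarrow>
     disjoint_family_on part (insert None (Some ` {1..d})) \<and>
     (\<Union>i \<in> insert None (Some ` {1..d}). part i) = {..<n} \<and>
     (\<forall>i \<in> {1..d}. card (part (Some i)) = nat \<lceil>(real f + 1) / 2\<rceil>) \<and>
     card (part None) = n - d * nat \<lceil>(real f + 1) / 2\<rceil>"

datatype 'v message = OUTPUT 'v

text \<open>A process of \<open>P\<^sub>i\<close> goes through \<open>Start\<close>, \<open>Announce\<close>, \<open>Done\<close>, hence may crash between its output
  and its communication. A process of \<open>P\<^sub>?\<close> goes through \<open>Waiting\<close>, \<open>Decide\<close>, \<open>Done\<close>; the argument of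
  \<open>Waiting\<close> is the set of the values \<open>v\<close> such that \<open>OUTPUT v\<close> has been observed so far, and the
  argument of \<open>Decide\<close> is the set \<open>V\<^sub>o\<^sub>b\<^sub>s\<close>, read at the moment at which the wait ends.\<close>

datatype 'v D_state = Start 'v | Announce 'v | Waiting "'v set" | Decide "'v set" | Done

definition D_wait :: "nat \<Rightarrow> 'v set \<Rightarrow> 'v D_state" where
  "D_wait d S = (if card S \<ge> d - 1 then Decide S else Waiting S)"

definition D_init :: "nat \<Rightarrow> (nat \<Rightarrow> 'v) \<Rightarrow> (nat option \<Rightarrow> nat set) \<Rightarrow> nat \<Rightarrow> 'v D_state" where
  "D_init d v part p =
     (if \<exists>i \<in> {1..d}. p \<in> part (Some i)
      then Start (v (THE i. i \<in> {1..d} \<and> p \<in> part (Some i))) else D_wait d {})"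

fun D_act :: "nat \<Rightarrow> (nat \<Rightarrow> 'v) \<Rightarrow> 'v D_state \<Rightarrow> ('v message, 'v) action" where
  "D_act d v (Start w) = Output w"
| "D_act d v (Announce w) = Communicate (OUTPUT w)"
| "D_act d v (Waiting S) = Skip"
| "D_act d v (Decide S) = Output (SOME w. w \<in> v ` {1..d} - S)"
| "D_act d v Done = Skip"

fun D_step :: "'v D_state \<Rightarrow> 'v D_state" where
  "D_step (Start w) = Announce w"
| "D_step (Announce w) = Done"
| "D_step (Waiting S) = Waiting S"
| "D_step (Decide S) = Done"
| "D_step Done = Done"

fun D_observe :: "nat \<Rightarrow> 'v message \<Rightarrow> 'v D_state \<Rightarrow> 'v D_state" where
  "D_observe d (OUTPUT w) (Waiting S) = D_wait d (insert w S)"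
| "D_observe d (OUTPUT w) s = s"

text \<open>Run in systems whose size belongs to \<open>N\<close>; the initialization uses the partition \<open>part n\<close> in
  a system of size \<open>n\<close>. Inputs are ignored.\<close>

definition algorithm_D ::
    "nat \<Rightarrow> (nat \<Rightarrow> 'v) \<Rightarrow> nat set \<Rightarrow> (nat \<Rightarrow> nat option \<Rightarrow> nat set) \<Rightarrow>
     ('v D_state, 'v message, 'v) algorithm" where
  "algorithm_D d v N part =
     \<lparr>inputs = {x. length x \<in> N},
      init = (\<lambda>n p _. D_init d v (part n) p),
      act = D_act d v,
      step = D_step,
      on_observe = D_observe d,
      on_tick = (\<lambda>s. s)\<rparr>"

end

theory Submission
  imports Defs
begin

text \<open>Two groups together have at least \<open>2 * \<lceil>(f + 1) / 2\<rceil> > f\<close> processes, so at most one group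
  \<open>P\<^sub>i\<close> can crash entirely. If \<open>v\<^sub>i\<close> is not output by \<open>P\<^sub>i\<close>, then \<open>P\<^sub>i\<close> has crashed entirely, every other
  group announces its value, and, since \<open>\<lceil>(f + 1) / 2\<rceil> + \<lfloor>(f + 1) / 2\<rfloor> > f\<close>, some process of \<open>P\<^sub>?\<close>
  survives. It observes exactly the \<open>d - 1\<close> other values and outputs \<open>v\<^sub>i\<close>. As inputs are ignored,
  the conditions other than safety only require one execution for each size: all processes take
  two local steps, then all of them observe one message per group.\<close>

section \<open>Runs of algorithm \<open>\<D>\<close>\<close>

lemma algorithm_D_sel [simp]:
  "inputs (algorithm_D d v N part) = {x. length x \<in> N}"
  "init (algorithm_D d v N part) n p inp = D_init d v (part n) p"
  "act (algorithm_D d v N part) = D_act d v"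
  "step (algorithm_D d v N part) = D_step"
  "on_observe (algorithm_D d v N part) = D_observe d"
  "on_tick (algorithm_D d v N part) = (\<lambda>s. s)"
  by (simp_all add: algorithm_D_def)

section \<open>Independence of runs from the input values\<close>

lemma state_at_D_cong:
  assumes "length x = length x'"
  shows "state_at (algorithm_D d v N part) x = state_at (algorithm_D d v N part) x'"
proof (intro ext)
  fix e p t
  show "state_at (algorithm_D d v N part) x e p t = state_at (algorithm_D d v N part) x' e p t"
  proof (induction t)
    case (Suc t)
    then show ?case
      by simp
  qed (simp add: assms)
qed

lemma performs_D_cong:
  "length x = length x' \<Longrightarrow>
    performs (algorithm_D d v N part) x = performs (algorithm_D d v N part) x'"
  by (intro ext) (simp add: performs_def state_at_D_cong[of x x'])

text \<open>The input vector enters a run only through its length. This is the source of the product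
  form of the task.\<close>

lemma execution_D_cong:
  "length x = length x' \<Longrightarrow>
    execution f (algorithm_D d v N part) x e = execution f (algorithm_D d v N part) x' e"
  by (simp add: execution_def C_Validity_def C_Local_Termination_def performs_D_cong[of x x'])

lemma output_vector_D_cong:
  "length x = length x' \<Longrightarrow>
    output_vector (algorithm_D d v N part) x e = output_vector (algorithm_D d v N part) x' e"
  by (simp add: output_vector_def performs_D_cong[of x x'])

text \<open>With at most one output event per process, the \<open>THE\<close> in
  \<open>output_vector\<close> denotes the value actually output; and only processes with an entry
  in the vector take steps.\<close>

lemma output_set_output_vector:
  assumes "outputs_at_most_once f A" "execution f A x e"
  shows "output_set (output_vector A x e) = {w. \<exists>p t. performs A x e t p (Output w)}"
proof -
  have same: "w = w'"
    if "performs A x e t p (Output w)" "performs A x e t' p (Output w')" for p t t' w w'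
  proof -
    have "t = t'"
      using assms that unfolding outputs_at_most_once_def by blast
    then show ?thesis
      using that by (simp add: performs_def)
  qed
  have the: "(THE w. \<exists>t. performs A x e t p (Output w)) = w"
    if "performs A x e t p (Output w)" for p t w
    using that same by blast
  have lt: "p < length x" if "performs A x e t p (Output w)" for p t w
    using assms(2) that unfolding execution_def performs_def by (metis actor.simps(1))
  show ?thesis
  proof (intro set_eqI iffI)
    fix w
    assume "w \<in> output_set (output_vector A x e)"
    then obtain p where "Some w = (if \<exists>t v. performs A x e t p (Output v)
              then Some (THE v. \<exists>t. performs A x e t p (Output v)) else None)"
      unfolding output_set_def output_vector_def mem_Collect_eq set_map by blast
    then show "w \<in> {w. \<exists>p t. performs A x e t p (Output w)}"
      using the by (auto split: if_splits)
  next
    fix w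
    assume "w \<in> {w. \<exists>p t. performs A x e t p (Output w)}"
    then obtain p t where "performs A x e t p (Output w)"
      by blast
    with lt the show "w \<in> output_set (output_vector A x e)"
      by (auto simp: output_set_def output_vector_def image_iff intro!: bexI[of _ p])
  qed
qed

section \<open>At most one output per process\<close>

fun undecided :: "'v D_state \<Rightarrow> bool" where
  "undecided (Start w) = True"
| "undecided (Announce w) = False"
| "undecided (Waiting S) = True"
| "undecided (Decide S) = True"
| "undecided Done = False"

lemma D_observe_not_undecided: "\<not> undecided s \<Longrightarrow> D_observe d m s = s"
  by (cases m; cases s) auto

lemma D_step_not_undecided: "\<not> undecided s \<Longrightarrow> \<not> undecided (D_step s)"
  by (cases s) auto

lemma D_act_Output: "D_act d v s = Output w \<Longrightarrow> undecided s \<and> \<not> undecided (D_step s)"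
  by (cases s) auto

lemma state_at_not_undecided:
  assumes "\<not> undecided (state_at (algorithm_D d v N part) x e p t)" "t \<le> t'"
  shows "\<not> undecided (state_at (algorithm_D d v N part) x e p t')"
  using assms(2,1)
proof (induction t' rule: dec_induct)
  case (step t')
  then show ?case
    by (cases "e t'") (auto simp: D_observe_not_undecided D_step_not_undecided)
qed

text \<open>An output is performed in an \<open>undecided\<close> state, and that very step leaves
  the \<open>undecided\<close> states for good.\<close>

lemma outputs_at_most_once_D: "outputs_at_most_once f (algorithm_D d v N part)"
proof -
  have False
    if "performs (algorithm_D d v N part) x e t p (Output w)"
      "performs (algorithm_D d v N part) x e t' p (Output w')" "t < t'" for x e p t t' w w'
  proof -
    have "\<not> undecided (state_at (algorithm_D d v N part) x e p (Suc t))"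
      using that(1) D_act_Output by (fastforce simp: performs_def)
    then have "\<not> undecided (state_at (algorithm_D d v N part) x e p t')"
      using that(3) state_at_not_undecided by (metis Suc_leI)
    then show False
      using that(2) D_act_Output by (fastforce simp: performs_def)
  qed
  then show ?thesis
    unfolding outputs_at_most_once_def by (metis linorder_neqE_nat)
qed

text \<open>This turns fairness into actual actions: a state that only a local step can change
  persists until the next local step of \<open>p\<close>, which exists since \<open>p\<close> takes
  infinitely many.\<close>

lemma stable_state_until_local_step:
  assumes "infinite {t. e t = Local p}"
    and "state_at A x e p t = s"
    and "\<And>a. actor a = Some p \<Longrightarrow> a \<noteq> Local p \<Longrightarrow> apply_event A a s = s"
  obtains t' where "t' \<ge> t" "e t' = Local p" "state_at A x e p t' = s"
proof -
  define u where "u = (LEAST u. u \<ge> t \<and> e u = Local p)"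
  have "\<exists>u. u \<ge> t \<and> e u = Local p"
    using assms(1) by (metis (mono_tags, lifting) finite_nat_set_iff_bounded linorder_not_le mem_Collect_eq)
  then have u: "u \<ge> t" "e u = Local p"
    unfolding u_def by (metis (mono_tags, lifting) LeastI)+
  have least: "e r \<noteq> Local p" if "t \<le> r" "r < u" for r
    using that not_less_Least unfolding u_def by blast
  have "state_at A x e p r = s" if "t \<le> r" "r \<le> u" for r
    using that
  proof (induction r rule: dec_induct)
    case base
    then show ?case
      by (simp add: assms(2))
  next
    case (step r)
    then show ?case
      using assms(3) least by simp
  qed
  with u that show thesis
    by blast
qed

section \<open>States and observations\<close>

lemma D_wait_cases:
  assumes "card S \<le> d - 1"
  obtains "D_wait d S = Decide S" "card S = d - 1" | "D_wait d S = Waiting S" "card S < d - 1"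
  using assms that by (cases "card S = d - 1") (simp_all add: D_wait_def)

text \<open>\<open>Announce w\<close> is entered only by a local step from \<open>Start w\<close>,
  and that step performs the output of \<open>w\<close>.\<close>

lemma Announce_after_Output:
  "state_at (algorithm_D d v N part) x e p t = Announce w \<Longrightarrow>
    \<exists>t' < t. performs (algorithm_D d v N part) x e t' p (Output w)"
proof (induction t)
  case 0
  then show ?case
    by (auto simp: D_init_def D_wait_def split: if_splits)
next
  case (Suc t)
  let ?s = "state_at (algorithm_D d v N part) x e p t"
  consider "?s = Announce w" | "e t = Local p" "?s = Start w"
  proof (cases "e t = Local p")
    case True
    then show ?thesis
      using Suc.prems that by (cases ?s) auto
  next
    case False
    have "D_observe d m ?s = Announce w \<Longrightarrow> ?s = Announce w" for m
      by (cases m; cases ?s) (auto simp: D_wait_def split: if_splits)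
    then show ?thesis
      using Suc.prems that False by (cases "e t") (auto split: if_splits)
  qed
  then show ?case
  proof cases
    case 1
    then show ?thesis
      using Suc.IH less_Suc_eq by blast
  next
    case 2
    then show ?thesis
      by (auto simp: performs_def)
  qed
qed

lemma Communicate_iff_Announce:
  "performs (algorithm_D d v N part) x e t p (Communicate (OUTPUT w)) \<longleftrightarrow>
    e t = Local p \<and> state_at (algorithm_D d v N part) x e p t = Announce w"
  by (cases "state_at (algorithm_D d v N part) x e p t") (auto simp: performs_def)

text \<open>Defined from the events alone, so that it keeps growing after the wait has ended,
  whereas the set stored in the state is then frozen.\<close>

definition observed :: "(nat \<Rightarrow> 'v message event) \<Rightarrow> nat \<Rightarrow> nat \<Rightarrow> 'v set" where
  "observed e p t = {w. \<exists>t' < t. \<exists>q. e t' = Observe p q (OUTPUT w)}"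

lemma observed_0 [simp]: "observed e p 0 = {}"
  by (simp add: observed_def)

lemma observed_Suc:
  "observed e p (Suc t) = observed e p t \<union> {w. \<exists>q. e t = Observe p q (OUTPUT w)}"
  by (auto simp: observed_def less_Suc_eq)

lemma mono_observed: "t \<le> t' \<Longrightarrow> observed e p t \<subseteq> observed e p t'"
  unfolding observed_def by (auto intro: less_le_trans)

text \<open>A waiting process has recorded all its observations, hence the equality;
  \<open>Decide\<close> ignores later ones, hence the inclusion. The strict bound rules out waiting
  with \<open>d - 1\<close> observed values, and the exact cardinality in \<open>Decide\<close>
  leaves a single one of \<open>d\<close> values to output.\<close>

fun D_invariant :: "nat \<Rightarrow> 'v set \<Rightarrow> 'v set \<Rightarrow> 'v D_state \<Rightarrow> bool" where
  "D_invariant d V Obs (Start w) = (w \<in> V)"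
| "D_invariant d V Obs (Announce w) = (w \<in> V)"
| "D_invariant d V Obs (Waiting S) = (S = Obs \<and> card S < d - 1)"
| "D_invariant d V Obs (Decide S) = (S \<subseteq> Obs \<and> card S = d - 1)"
| "D_invariant d V Obs Done = True"

lemma D_invariant_step:
  "D_invariant d V Obs s \<Longrightarrow> D_invariant d V Obs (D_step s)"
  by (cases s) auto

text \<open>One insertion raises a cardinality below \<open>d - 1\<close> to at most
  \<open>d - 1\<close>, so the threshold of \<open>D_wait\<close> is met with equality and never
  overshot.\<close>

lemma D_invariant_observe:
  assumes "D_invariant d V Obs s"
  shows "D_invariant d V (insert w Obs) (D_observe d (OUTPUT w) s)"
proof (cases s)
  case (Waiting S)
  then have S: "S = Obs" "card (insert w S) \<le> d - 1"
    using assms card_insert_le_m1[of "d - 1" S w] by auto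
  from S(2) show ?thesis
    by (rule D_wait_cases) (use S(1) in \<open>auto simp: Waiting\<close>)
qed (use assms in auto)

lemma D_init_group:
  assumes "disjoint_family_on P (Some ` {1..d})" "i \<in> {1..d}" "p \<in> P (Some i)"
  shows "D_init d v P p = Start (v i)"
proof -
  have "j = i" if "j \<in> {1..d}" "p \<in> P (Some j)" for j
    using disjoint_family_onD[OF assms(1), of "Some i" "Some j"] assms(2,3) that by blast
  then have "(THE i. i \<in> {1..d} \<and> p \<in> P (Some i)) = i"
    using assms(2,3) by (intro the_equality) blast+
  then show ?thesis
    using assms(2,3) by (auto simp: D_init_def)
qed

lemma D_invariant_init:
  assumes "disjoint_family_on P (Some ` {1..d})"
  shows "D_invariant d (v ` {1..d}) {} (D_init d v P p)"
proof (cases "\<exists>i \<in> {1..d}. p \<in> P (Some i)")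
  case True
  then obtain i where i: "i \<in> {1..d}" "p \<in> P (Some i)"
    by blast
  then show ?thesis
    using D_init_group[OF assms i, of v] by simp
next
  case False
  \<comment> \<open>With \<open>d \<le> 1\<close> the threshold is 0 and the process starts in
    \<open>Decide {}\<close>; otherwise it starts in \<open>Waiting {}\<close>.\<close>
  then show ?thesis
    by (auto simp: D_init_def D_wait_def)
qed

lemma D_invariant_state_at:
  assumes "disjoint_family_on (part (length x)) (Some ` {1..d})"
  shows "D_invariant d (v ` {1..d}) (observed e p t) (state_at (algorithm_D d v N part) x e p t)"
proof (induction t)
  case 0
  then show ?case
    using D_invariant_init[OF assms, of v p] by simp
next
  case (Suc t)
  show ?case
  proof (cases "\<exists>q w. e t = Observe p q (OUTPUT w)")
    case True
    then obtain q w where e: "e t = Observe p q (OUTPUT w)"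
      by blast
    then have "observed e p (Suc t) = insert w (observed e p t)"
      by (auto simp: observed_Suc)
    with Suc e show ?thesis
      by (simp add: D_invariant_observe)
  next
    case False
    then have "observed e p (Suc t) = observed e p t"
      by (auto simp: observed_Suc)
    \<comment> \<open>Without an observation by \<open>p\<close>, only a local step of
      \<open>p\<close> can change its state.\<close>
    moreover have "state_at (algorithm_D d v N part) x e p (Suc t)
        \<in> {state_at (algorithm_D d v N part) x e p t, D_step (state_at (algorithm_D d v N part) x e p t)}"
    proof (cases "e t")
      case (Observe p' q m)
      with False show ?thesis
        by (cases m) auto
    qed auto
    ultimately show ?thesis
      using Suc D_invariant_step by fastforce
  qed
qed


section \<open>Safety\<close>

text \<open>The ceiling is \<open>(f + 2) div 2\<close> and the floor is
  \<open>(f + 1) div 2\<close>. Their sum exceeds the crash bound by one, on which the counting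
  arguments rely.\<close>

lemma ceiling_plus_floor_half:
  "nat \<lceil>(real f + 1) / 2\<rceil> + nat \<lfloor>(real f + 1) / 2\<rfloor> = f + 1"
  "nat \<lfloor>(real f + 1) / 2\<rfloor> \<le> nat \<lceil>(real f + 1) / 2\<rceil>"
proof -
  have "\<lfloor>(real f + 1) / 2\<rfloor> = int ((f + 1) div 2)"
    by (rule floor_unique; cases "even f") (auto elim!: evenE oddE)
  then have floor: "nat \<lfloor>(real f + 1) / 2\<rfloor> = (f + 1) div 2"
    by (simp only: nat_int)
  have "\<lceil>(real f + 1) / 2\<rceil> = int ((f + 2) div 2)"
    by (rule ceiling_unique; cases "even f") (auto elim!: evenE oddE)
  then have ceil: "nat \<lceil>(real f + 1) / 2\<rceil> = (f + 2) div 2"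
    by (simp only: nat_int)
  show "nat \<lceil>(real f + 1) / 2\<rceil> + nat \<lfloor>(real f + 1) / 2\<rfloor> = f + 1"
    "nat \<lfloor>(real f + 1) / 2\<rfloor> \<le> nat \<lceil>(real f + 1) / 2\<rceil>"
    unfolding floor ceil by presburger+
qed

locale D_system =
  fixes d f :: nat
    and v :: "nat \<Rightarrow> 'v::finite"
    and N :: "nat set"
    and part :: "nat \<Rightarrow> nat option \<Rightarrow> nat set"
  assumes d_pos: "d \<ge> 1"
    and inj_v: "inj_on v {1..d}"
    and size_bound: "n \<in> N \<Longrightarrow>
           n \<ge> d * nat \<lceil>(real f + 1) / 2\<rceil> + nat \<lfloor>(real f + 1) / 2\<rfloor>"
    and partition: "n \<in> N \<Longrightarrow> D_partition d f n (part n)"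
begin

abbreviation A :: "('v D_state, 'v message, 'v) algorithm" where
  "A \<equiv> algorithm_D d v N part"

section \<open>Counting processes against crashes\<close>

lemma card_values: "card (v ` {1..d}) = d"
  using card_image[OF inj_v] by simp

lemma group_disjoint:
  assumes "n \<in> N" "i \<in> insert None (Some ` {1..d})" "j \<in> insert None (Some ` {1..d})" "i \<noteq> j"
  shows "part n i \<inter> part n j = {}"
proof -
  have "disjoint_family_on (part n) (insert None (Some ` {1..d}))"
    using partition[OF assms(1)] by (simp only: D_partition_def)
  then show ?thesis
    using assms(2-) by (rule disjoint_family_onD)
qed

lemma group_subset:
  assumes "n \<in> N" "i \<in> insert None (Some ` {1..d})"
  shows "part n i \<subseteq> {..<n}"
proof -
  have "(\<Union>i \<in> insert None (Some ` {1..d}). part n i) = {..<n}"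
    using partition[OF assms(1)] by (simp only: D_partition_def)
  then show ?thesis
    using assms(2) by blast
qed

text \<open>\<open>P\<^sub>i\<close> contributes the ceiling of \<open>(f + 1) / 2\<close>. The
  other class contributes at least the floor: a group by its size, \<open>P\<^sub>?\<close> by the
  lower bound on \<open>n\<close>. The classes are disjoint, so the contributions add up to at least
  \<open>f + 1\<close>.\<close>

lemma card_two_groups:
  assumes "n \<in> N" "i \<in> {1..d}" "j \<in> insert None (Some ` {1..d})" "Some i \<noteq> j"
  shows "card (part n (Some i) \<union> part n j) > f"
proof -
  have fin: "finite (part n k)" if "k \<in> insert None (Some ` {1..d})" for k
    using group_subset[OF assms(1) that] finite_subset by blast
  have "card (part n j) \<ge> nat \<lfloor>(real f + 1) / 2\<rfloor>"
    using partition[OF assms(1)] size_bound[OF assms(1)] assms(3) ceiling_plus_floor_half(2)[of f]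
    by (auto simp: D_partition_def)
  moreover have "card (part n (Some i)) = nat \<lceil>(real f + 1) / 2\<rceil>"
    using partition[OF assms(1)] assms(2) by (auto simp: D_partition_def)
  ultimately show ?thesis
    using group_disjoint[OF assms(1) _ assms(3,4)] assms(2,3) fin ceiling_plus_floor_half(1)[of f]
    by (subst card_Un_disjoint) auto
qed

lemma size_gt_f:
  assumes "n \<in> N"
  shows "n > f"
proof -
  have "card (part n (Some 1) \<union> part n None) \<le> card {..<n}"
    using group_subset[OF assms] d_pos by (intro card_mono) auto
  then show ?thesis
    using card_two_groups[OF assms, of 1 None] d_pos by simp
qed

lemma groups_disjoint_family: "n \<in> N \<Longrightarrow> disjoint_family_on (part n) (Some ` {1..d})"
  unfolding disjoint_family_on_def by (intro ballI impI group_disjoint) auto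

lemmas init_group = D_init_group[OF groups_disjoint_family]

lemma init_rest:
  assumes "n \<in> N" "p \<in> part n None"
  shows "D_init d v (part n) p = D_wait d {}"
proof -
  have "p \<notin> part n (Some i)" if "i \<in> {1..d}" for i
    using group_disjoint[OF assms(1), of None "Some i"] assms(2) that by blast
  then show ?thesis
    by (auto simp: D_init_def)
qed

lemma invariant:
  assumes "length x \<in> N"
  shows "D_invariant d (v ` {1..d}) (observed e p t) (state_at A x e p t)"
  using groups_disjoint_family[OF assms] by (rule D_invariant_state_at)

text \<open>A set of \<open>d - 1\<close> elements cannot cover \<open>d\<close> values, where
  \<open>d \<ge> 1\<close> ensures \<open>d - 1 < d\<close>. Hence the \<open>SOME\<close> of a
  deciding process has a witness.\<close>

lemma Decide_output:
  assumes "card S = d - 1"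
  shows "(SOME w. w \<in> v ` {1..d} - S) \<in> v ` {1..d} - S"
proof -
  have "v ` {1..d} - S \<noteq> {}"
  proof
    assume "v ` {1..d} - S = {}"
    then have "card (v ` {1..d}) \<le> card S"
      by (intro card_mono) auto
    then show False
      using assms card_values d_pos by simp
  qed
  then show ?thesis
    by (metis some_in_eq)
qed

lemma Output_in_values:
  assumes "length x \<in> N" "performs A x e t p (Output w)"
  shows "w \<in> v ` {1..d}"
proof (cases "state_at A x e p t")
  case (Decide S)
  then have "w \<in> v ` {1..d} - S"
    using assms(2) invariant[OF assms(1), of e p t] Decide_output[of S] by (simp add: performs_def)
  then show ?thesis
    by blast
qed (use assms(2) invariant[OF assms(1), of e p t] in \<open>simp_all add: performs_def\<close>)

text \<open>By validity the message was communicated; its sender was then in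
  \<open>Announce\<close>, and so had output the value before.\<close>

lemma observed_is_output:
  assumes "execution f A x e" "w \<in> observed e p t"
  shows "\<exists>q t'. performs A x e t' q (Output w)"
proof -
  obtain r q where "e r = Observe p q (OUTPUT w)"
    using assms(2) by (auto simp: observed_def)
  then obtain t' where "performs A x e t' q (Communicate (OUTPUT w))"
    using assms(1) unfolding execution_def C_Validity_def by blast
  then have "state_at A x e q t' = Announce w"
    by (simp add: Communicate_iff_Announce)
  then show ?thesis
    using Announce_after_Output by metis
qed

section \<open>Correct processes in a fixed execution\<close>

context
  fixes x :: "'v vec" and e :: "nat \<Rightarrow> 'v message event"
  assumes exec: "execution f A x e"
begin

lemma size_in_N: "length x \<in> N"
  using exec by (simp add: execution_def)

lemma correct_steps: "p \<in> correct (length x) e \<Longrightarrow> infinite {t. e t = Local p}"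
  using exec by (simp add: execution_def)

text \<open>Observations and ticks do not affect \<open>Start\<close> and \<open>Announce\<close>,
  so fairness leads a correct process to a local step in each of these two states.\<close>

lemma correct_group_acts:
  assumes "i \<in> {1..d}" "p \<in> part (length x) (Some i)" "p \<in> correct (length x) e"
  shows "\<exists>t. performs A x e t p (Output (v i))"
    and "\<exists>t. performs A x e t p (Communicate (OUTPUT (v i)))"
proof -
  have stable: "apply_event A a s = s"
    if "actor a = Some p" "a \<noteq> Local p" "s \<in> {Start (v i), Announce (v i)}" for a s
  proof (cases a)
    case (Observe p' q m)
    then show ?thesis
      using that by (cases m) auto
  qed (use that in auto)
  have "state_at A x e p 0 = Start (v i)"
    using init_group size_in_N assms by simp
  then obtain t where t: "e t = Local p" "state_at A x e p t = Start (v i)"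
    using stable_state_until_local_step[OF correct_steps[OF assms(3)]] stable by (metis insertCI)
  then show "\<exists>t. performs A x e t p (Output (v i))"
    by (auto simp: performs_def)
  have "state_at A x e p (Suc t) = Announce (v i)"
    using t by simp
  then obtain t' where "e t' = Local p" "state_at A x e p t' = Announce (v i)"
    using stable_state_until_local_step[OF correct_steps[OF assms(3)]] stable by (metis insertCI)
  then show "\<exists>t. performs A x e t p (Communicate (OUTPUT (v i)))"
    by (auto simp: performs_def)
qed

text \<open>Otherwise both classes would have crashed entirely, which is more than \<open>f\<close>
  processes.\<close>

lemma correct_in_other_group:
  assumes "i \<in> {1..d}" "part (length x) (Some i) \<inter> correct (length x) e = {}"
    and "j \<in> insert None (Some ` {1..d})" "Some i \<noteq> j"
  shows "\<exists>p. p \<in> part (length x) j \<inter> correct (length x) e"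
proof (rule ccontr)
  assume "\<not> ?thesis"
  then have "part (length x) (Some i) \<union> part (length x) j \<subseteq> crashed e"
    using assms(2) group_subset[OF size_in_N] assms(1,3) unfolding correct_def by blast
  moreover have "crashed e \<subseteq> {..<length x}"
  proof
    fix p
    assume "p \<in> crashed e"
    then obtain t where "e t = Crash p"
      unfolding crashed_def by blast
    then have "actor (e t) = Some p"
      by simp
    then show "p \<in> {..<length x}"
      using exec unfolding execution_def by blast
  qed
  ultimately have "card (part (length x) (Some i) \<union> part (length x) j) \<le> card (crashed e)"
    by (meson card_mono finite_lessThan finite_subset)
  also have "\<dots> \<le> f"
    using exec by (simp add: execution_def)
  finally show False
    using card_two_groups[OF size_in_N assms(1,3,4)] by simp
qed

text \<open>The only exit from \<open>Waiting\<close> is \<open>Decide\<close>, through an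
  observation that reaches the threshold.\<close>

lemma waiting_state_at:
  assumes "p \<in> part (length x) None" "\<And>t S. state_at A x e p t \<noteq> Decide S"
  shows "\<exists>S. state_at A x e p t = Waiting S"
proof (induction t)
  case 0
  show ?case
    using init_rest[OF size_in_N assms(1)] assms(2)[of 0] by (auto simp: D_wait_def split: if_splits)
next
  case (Suc t)
  then obtain S where S: "state_at A x e p t = Waiting S"
    by blast
  show ?case
  proof (cases "e t")
    case (Observe p' q m)
    obtain w where "m = OUTPUT w"
      by (cases m)
    then show ?thesis
      using S Observe assms(2)[of "Suc t" "insert w S"]
      by (auto simp: D_wait_def split: if_splits)
  qed (use S in auto)
qed

lemma all_values_output:
  assumes "i \<in> {1..d}"
  shows "\<exists>p t. performs A x e t p (Output (v i))"
proof (rule ccontr)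
  assume none: "\<not> ?thesis"
  then have crashed: "part (length x) (Some i) \<inter> correct (length x) e = {}"
    using correct_group_acts(1)[OF assms] by blast
  obtain p where p: "p \<in> part (length x) None" "p \<in> correct (length x) e"
    using correct_in_other_group[OF assms crashed, of None] by auto
  \<comment> \<open>The message of group \<open>j\<close> reaches \<open>p\<close> in two stages:
    local termination brings it to some correct process, and global termination from there to all of
    them.\<close>
  have "\<exists>t. v j \<in> observed e p t" if j: "j \<in> {1..d} - {i}" for j
  proof -
    obtain q where q: "q \<in> part (length x) (Some j)" "q \<in> correct (length x) e"
      using correct_in_other_group[OF assms crashed, of "Some j"] j by blast
    then obtain t where "performs A x e t q (Communicate (OUTPUT (v j)))"
      using correct_group_acts(2) j by blast
    then obtain p' where "p' \<in> correct (length x) e" "observes e p' (OUTPUT (v j))"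
      using q exec unfolding execution_def C_Local_Termination_def by blast
    then have "observes e p (OUTPUT (v j))"
      using p exec unfolding execution_def C_Global_Termination_def by blast
    then show ?thesis
      by (auto simp: observes_def observed_def)
  qed
  then have "\<forall>j \<in> {1..d} - {i}. \<exists>t. v j \<in> observed e p t"
    by blast
  from bchoice[OF this] obtain T where T: "\<forall>j \<in> {1..d} - {i}. v j \<in> observed e p (T j)"
    by blast
  \<comment> \<open>By time \<open>m\<close> all the other values have been observed. The maximum
    includes the arbitrary \<open>T i\<close>, which can only make \<open>m\<close> larger.\<close>
  define m where "m = Max (T ` {1..d})"
  have "v j \<in> observed e p m" if "j \<in> {1..d} - {i}" for j
  proof -
    have "T j \<le> m"
      unfolding m_def using that by (intro Max_ge) auto
    then show ?thesis
      using T that mono_observed[of "T j" m e p] by (meson subsetD)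
  qed
  then have "v ` ({1..d} - {i}) \<subseteq> observed e p m"
    by blast
  moreover have "card (v ` ({1..d} - {i})) = d - 1"
    using assms inj_v by (subst card_image) (auto intro: inj_on_subset)
  ultimately have m: "card (observed e p m) \<ge> d - 1"
    by (metis card_mono finite)
  \<comment> \<open>A process still waiting at time \<open>m\<close> would have stored all of
    \<open>observed e p m\<close>, against the strict bound in the invariant.\<close>
  have "\<exists>t S. state_at A x e p t = Decide S"
  proof (rule ccontr)
    assume "\<not> ?thesis"
    then obtain S where "state_at A x e p m = Waiting S"
      using waiting_state_at[OF p(1)] by blast
    then show False
      using invariant[OF size_in_N, of e p m] m by auto
  qed
  then obtain t0 S where "state_at A x e p t0 = Decide S"
    by blast
  moreover have "apply_event A a (Decide S) = Decide S"
    if "actor a = Some p" "a \<noteq> Local p" for a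
  proof (cases a)
    case (Observe p' q m)
    then show ?thesis
      by (cases m) auto
  qed (use that in auto)
  ultimately obtain t where t: "e t = Local p" "state_at A x e p t = Decide S"
    using stable_state_until_local_step[OF correct_steps[OF p(2)]] by metis
  have S: "S \<subseteq> observed e p t" "card S = d - 1"
    using invariant[OF size_in_N, of e p t] t by simp_all
  \<comment> \<open>Values in \<open>S\<close> were observed, hence output, hence differ from
    \<open>v i\<close>. Having \<open>d - 1\<close> elements, \<open>S\<close> consists of all the
    other values, which forces the choice of \<open>v i\<close>.\<close>
  have "S \<subseteq> v ` {1..d} - {v i}"
    using S(1) observed_is_output[OF exec] Output_in_values[OF size_in_N] none by blast
  moreover have "card (v ` {1..d} - {v i}) = d - 1"
    using assms card_values by (subst card_Diff_singleton) auto
  ultimately have "S = v ` {1..d} - {v i}"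
    using S(2) by (intro card_subset_eq) auto
  then have "(SOME w. w \<in> v ` {1..d} - S) = v i"
    using Decide_output[OF S(2)] by blast
  then have "performs A x e t p (Output (v i))"
    using t by (simp add: performs_def)
  with none show False
    by blast
qed

lemma output_set_eq: "output_set (output_vector A x e) = v ` {1..d}"
  using output_set_output_vector[OF outputs_at_most_once_D exec] Output_in_values[OF size_in_N]
    all_values_output by blast

end


section \<open>A crash-free execution\<close>

context
  fixes x :: "'v vec"
  assumes size: "length x \<in> N"
begin

definition leader :: "nat \<Rightarrow> nat" where
  "leader i = (SOME p. p \<in> part (length x) (Some i))"

text \<open>In round \<open>r\<close> all processes act in turn; rounds \<open>2, ..., d + 1\<close> deliver the message of group
  \<open>r - 1\<close>, sent by its leader in round \<open>1\<close>.\<close>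

definition schedule :: "nat \<Rightarrow> 'v message event" where
  "schedule t = (let r = t div length x; p = t mod length x in
     if 2 \<le> r \<and> r < d + 2 then Observe p (leader (r - 1)) (OUTPUT (v (r - 1)))
     else if r < 2 \<or> even r then Local p else Tick p)"

lemma size_pos: "length x > 0"
  using size_gt_f[OF size] by linarith

lemma schedule_round:
  assumes "p < length x"
  shows "schedule (r * length x + p) =
     (if 2 \<le> r \<and> r < d + 2 then Observe p (leader (r - 1)) (OUTPUT (v (r - 1)))
     else if r < 2 \<or> even r then Local p else Tick p)"
proof -
  have "(r * length x + p) div length x = r" "(r * length x + p) mod length x = p"
    using assms size_pos by simp_all
  then show ?thesis
    by (simp only: schedule_def Let_def)
qed

text \<open>The group index is the round number minus one, so \<open>i\<close> and \<open>p\<close>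
  determine the position \<open>t\<close>; integrity rests on this.\<close>

lemma schedule_Observe:
  assumes "schedule t = Observe p q m"
  obtains i where "i \<in> {1..d}" "p < length x" "t = (i + 1) * length x + p"
    "q = leader i" "m = OUTPUT (v i)"
proof -
  have r: "2 \<le> t div length x" "t div length x < d + 2" "p = t mod length x"
    "q = leader (t div length x - 1)" "m = OUTPUT (v (t div length x - 1))"
    using assms by (auto simp: schedule_def Let_def split: if_splits)
  show thesis
  proof (rule that[of "t div length x - 1"])
    show "t = (t div length x - 1 + 1) * length x + p"
      using r(1,3) by (simp del: mult_Suc)
  qed (use r size_pos in auto)
qed

lemma leader_in_group:
  assumes "i \<in> {1..d}"
  shows "leader i \<in> part (length x) (Some i)"
proof -
  have "card (part (length x) (Some i)) > 0"
    using partition[OF size] assms ceiling_plus_floor_half[of f] by (auto simp: D_partition_def)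
  then have "part (length x) (Some i) \<noteq> {}"
    by force
  then show ?thesis
    unfolding leader_def by (metis some_in_eq)
qed

text \<open>The leader outputs at position \<open>leader i\<close> and communicates at
  \<open>length x + leader i\<close>. Every process has exactly one turn in each of the rounds 0 and
  1, so nothing changes its state in between.\<close>

lemma leader_communicates:
  assumes "i \<in> {1..d}"
  shows "performs A x schedule (length x + leader i) (leader i) (Communicate (OUTPUT (v i)))"
proof -
  let ?q = "leader i"
  have q: "?q < length x"
    using leader_in_group[OF assms] group_subset[OF size, of "Some i"] assms by auto
  have first: "schedule t = Local t" if "t < length x" for t
    using schedule_round[OF that, of 0] by simp
  have second: "schedule (length x + t) = Local t" if "t < length x" for t
    using schedule_round[OF that, of 1] by simp
  have "state_at A x schedule ?q t = Start (v i)" if "t \<le> ?q" for t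
    using that q
  proof (induction t)
    case 0
    then show ?case
      using init_group[OF size assms leader_in_group[OF assms]] by simp
  qed (simp add: first)
  then have sent: "state_at A x schedule ?q (Suc ?q) = Announce (v i)"
    using first[OF q] by simp
  have other: "actor (schedule t) \<noteq> Some ?q" if "?q < t" "t < length x + ?q" for t
  proof (cases "t < length x")
    case False
    then show ?thesis
      using second[of "t - length x"] that q by simp
  qed (use that first in auto)
  have "state_at A x schedule ?q t = Announce (v i)"
    if "Suc ?q \<le> t" "t \<le> length x + ?q" for t
    using that
  proof (induction t rule: dec_induct)
    case base
    show ?case
      by (rule sent)
  qed (use other in simp)
  then show ?thesis
    using second[OF q] q by (simp add: performs_def)
qed

text \<open>Meant for the rounds after the deliveries, where even rounds consist of local steps and
  odd rounds of ticks: the rounds \<open>2 * k + r\<close> all have the parity of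
  \<open>r\<close>.\<close>

lemma infinite_periodic: "infinite {t. schedule t = a}"
  if "p < length x" "\<And>k. schedule ((2 * k + r) * length x + p) = a" for p r a
proof -
  have "inj (\<lambda>k. (2 * k + r) * length x + p)"
    using size_pos by (intro injI) auto
  then have "infinite (range (\<lambda>k. (2 * k + r) * length x + p))"
    using finite_imageD infinite_UNIV_nat by blast
  moreover have "range (\<lambda>k. (2 * k + r) * length x + p) \<subseteq> {t. schedule t = a}"
    using that(2) by blast
  ultimately show ?thesis
    using finite_subset by blast
qed

lemma execution_schedule: "execution f A x schedule"
proof -
  have no_crash: "schedule t \<noteq> Crash p" for t p
    by (simp add: schedule_def Let_def)
  then have crashed: "crashed schedule = {}"
    by (simp add: crashed_def)
  then have correct: "correct (length x) schedule = {..<length x}"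
    by (simp add: correct_def)
  have actors: "p < length x" if "actor (schedule t) = Some p" for t p
    using that size_pos by (auto simp: schedule_def Let_def split: if_splits)
  \<comment> \<open>The offsets \<open>2 * d + 2\<close> and \<open>2 * d + 3\<close> lie beyond the
    last delivery round \<open>d + 1\<close> and are even and odd, respectively.\<close>
  have "infinite {t. schedule t = Local p}" if "p < length x" for p
    using that by (rule infinite_periodic[where r = "2 * d + 2"])
      (use schedule_round[OF that, of "2 * k + (2 * d + 2)" for k] in simp)
  moreover have "infinite {t. schedule t = Tick p}" if "p < length x" for p
    using that by (rule infinite_periodic[where r = "2 * d + 3"])
      (use schedule_round[OF that, of "2 * k + (2 * d + 3)" for k] in simp)
  moreover have "C_Validity A x schedule"
    unfolding C_Validity_def
  proof (intro allI impI)
    fix t p q m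
    assume "schedule t = Observe p q m"
    then obtain i where i: "i \<in> {1..d}" "t = (i + 1) * length x + p" "q = leader i" "m = OUTPUT (v i)"
      by (rule schedule_Observe)
    have "leader i < length x"
      using leader_in_group[OF i(1)] group_subset[OF size, of "Some i"] i(1) by auto
    \<comment> \<open>The observation falls into round \<open>i + 1 \<ge> 2\<close>, after the
      leader has communicated in round 1.\<close>
    moreover have "2 * length x \<le> (i + 1) * length x"
      using i(1) by (intro mult_le_mono1) auto
    ultimately have "length x + leader i < t"
      using i(2) by linarith
    then show "\<exists>t' < t. performs A x schedule t' q (Communicate m)"
      using leader_communicates i by blast
  qed
  moreover have "C_Integrity schedule"
    unfolding C_Integrity_def
  proof (intro allI impI, elim conjE)
    fix t t' p q m
    assume "schedule t = Observe p q m" "schedule t' = Observe p q m"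
    \<comment> \<open>As \<open>v\<close> is injective, the message determines the group, hence the
      round and the position.\<close>
    then show "t = t'"
      using inj_v by (elim schedule_Observe) (auto dest: inj_onD)
  qed
  \<comment> \<open>Both termination properties concern the information and not its sender, so
    delivering the copy of the leader also serves the other members of its group.\<close>
  moreover have all_observe: "observes schedule p (OUTPUT w)"
    if w: "w \<in> v ` {1..d}" and p: "p < length x" for p w
  proof -
    obtain i where "i \<in> {1..d}" "w = v i"
      using w by blast
    then show ?thesis
      using schedule_round[OF p, of "i + 1"] unfolding observes_def by fastforce
  qed
  moreover have "C_Local_Termination A x schedule"
    unfolding C_Local_Termination_def
  proof (intro ballI allI impI)
    fix p t m
    assume p: "p \<in> correct (length x) schedule" and "performs A x schedule t p (Communicate m)"
    moreover obtain w where w: "m = OUTPUT w"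
      by (cases m)
    ultimately have "state_at A x schedule p t = Announce w"
      by (simp add: Communicate_iff_Announce)
    then have "w \<in> v ` {1..d}"
      using invariant[OF size, of schedule p t] by simp
    then have "observes schedule p m"
      using all_observe p correct w by simp
    with p show "\<exists>p' \<in> correct (length x) schedule. observes schedule p' m"
      by blast
  qed
  moreover have "C_Global_Termination (length x) schedule"
    unfolding C_Global_Termination_def
  proof (intro ballI allI impI)
    fix p p' m
    assume "observes schedule p m" and p': "p' \<in> correct (length x) schedule"
    then obtain t q where "schedule t = Observe p q m"
      by (auto simp: observes_def)
    then obtain i where "i \<in> {1..d}" "m = OUTPUT (v i)"
      by (rule schedule_Observe)
    then show "observes schedule p' m"
      using all_observe p' correct by simp
  qed
  ultimately show ?thesis
    unfolding execution_def using size size_gt_f[OF size] size_pos actors no_crash crashed correct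
    by auto
qed

end

section \<open>From executions to the task\<close>

lemma algorithm_task_in_SOS_problem:
  assumes "N \<noteq> {}"
  shows "algorithm_task f A \<in> SOS_problem {v ` {1..d}}"
proof -
  have len: "length (output_vector A x e) = length x" for x e
    by (simp add: output_vector_def)
  have ex: "\<exists>e. execution f A x e" if "length x \<in> N" for x
    using execution_schedule[OF that] by blast
  have "is_task (algorithm_task f A)"
  proof -
    obtain n where "n \<in> N"
      using assms by blast
    then obtain e where "execution f A (replicate n None) e"
      using ex[of "replicate n None"] by auto
    then show ?thesis
      unfolding is_task_def algorithm_task_def using size_in_N len by auto
  qed
  moreover have "SOS (restrict_task (algorithm_task f A) n) = {v ` {1..d}} \<and>
      (case restrict_task (algorithm_task f A) n of (In, Out, \<Delta>) \<Rightarrow> \<Delta> = In \<times> Out)"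
    if "restrict_task (algorithm_task f A) n \<noteq> ({}, {}, {})" for n
  proof -
    have n: "n \<in> N"
      using that size_in_N len by (auto simp: restrict_task_def algorithm_task_def)
    then obtain e where "execution f A (replicate n None) e"
      using ex[of "replicate n None"] by auto
    then have "SOS (restrict_task (algorithm_task f A) n) = {v ` {1..d}}"
      using output_set_eq len
      by (auto simp: SOS_def restrict_task_def algorithm_task_def) (metis length_replicate)
    \<comment> \<open>An output vector produced on \<open>x'\<close> is also produced on every
      \<open>x\<close> of the same size, so all pairs of size \<open>n\<close> occur.\<close>
    moreover have "\<exists>e'. y = output_vector A x e' \<and> execution f A x e'"
      if "y = output_vector A x' e" "execution f A x' e" "length x = length x'" for x x' y e
      using that execution_D_cong[of x x'] output_vector_D_cong[of x x'] by metis
    ultimately show ?thesis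
      using n len size_in_N
      by (fastforce simp: restrict_task_def algorithm_task_def)
  qed
  ultimately show ?thesis
    by (simp add: SOS_problem_def)
qed

end

theorem theorem6:
  fixes d f :: nat
    and v :: "nat \<Rightarrow> 'v::finite"
    and N :: "nat set"
    and part :: "nat \<Rightarrow> nat option \<Rightarrow> nat set"
  assumes "d \<ge> 1"
    and "inj_on v {1..d}"
    and "N \<noteq> {}"
    and "\<And>n. n \<in> N \<Longrightarrow>
           n \<ge> d * nat \<lceil>(real f + 1) / 2\<rceil> + nat \<lfloor>(real f + 1) / 2\<rfloor>"
    and "\<And>n. n \<in> N \<Longrightarrow> D_partition d f n (part n)"
  shows "implements_problem f (algorithm_D d v N part) (SOS_problem {v ` {1..d}})"
proof -
  interpret D_system d f v N part
    using assms by unfold_locales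
  show ?thesis
    unfolding implements_problem_def implements_task_def
    using algorithm_task_in_SOS_problem[OF assms(3)] outputs_at_most_once_D by blast
qed

end
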